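(* Let $\mathcal{C}$ be a combinatorial class with a composition rule $\blacktriangleleft$ and a decomposition rule $\langle\cdot\rangle$ satisfying conditions (C1)–(C3), (D1)–(D3) and (CD1) written out in the context, with $\text{\O}\in\mathcal{C}$ the neutral and void object. Let $\mathbb{K}$ be a field, $\mathscr{C}=\mathbb{K}\,\mathcal{C}$ the vector space with basis $\mathcal{C}$, and let $(\mathscr{C},+,*,\text{\O},\Delta,\varepsilon)$ be the bi-algebra defined on basis elements by $$\Gamma_2*\Gamma_1=\sum_{\Gamma\in\Gamma_2\blacktriangleleft\Gamma_1}\Gamma,\qquad \Delta(\Gamma)=\sum_{(\Gamma'',\Gamma')\in\langle\Gamma\rangle}\Gamma''\otimes\Gamma',\qquad \varepsilon(\Gamma)=\begin{cases}1&\text{if }\Gamma=\text{\O},\\0&\text{otherwise.}\end{cases}$$ Suppose furthermore that for each $\Gamma\in\mathcal{C}$ there exists $N\in\mathbb{N}$ such that for all $n\geq N$ there is no multiple decomposition $\Gamma\leadsto(\Gamma_n,\dots,\Gamma_1)$ with $\Gamma_n,\dots,\Gamma_1\neq\text{\O}$. Let $S:\mathscr{C}\to\mathscr{C}$ be the linear map defined by $S(\text{\O})=\text{\O}$ and, for basis elements $\Gamma\neq\text{\O}$, $$S(\Gamma)=\sum_{\substack{\Gamma\leadsto(\Gamma_n,\dots,\Gamma_1)\\ \Gamma_n,\dots,\Gamma_1\neq\text{\O}}}(-1)^n\,\Gamma_n*\dots*\Gamma_1,$$ where the sum is over all $n\geq 1$ and all multiple decompositions of $\Gamma$ into $n$ components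 different from $\text{\O}$, counted with multiplicity. Then $S$ is an antipode, making this bi-algebra into a Hopf algebra $(\mathscr{C},+,*,\text{\O},\Delta,\varepsilon,S)$.
   Context: A multiset is a pair $(A,m)$ with $A$ a set and $m:A\to\mathbb{N}_{\geq 1}$ a multiplicity function; equality of multisets means equality of underlying sets and of multiplicities. The sum $\uplus$ of multisets adds multiplicities, and the product $A\times B$ has multiplicities $m_{A\times B}((a,b))=m_A(a)\,m_B(b)$. Sums and unions indexed by multisets count elements with multiplicity. A combinatorial class $\mathcal{C}$ is a denumerable collection of objects. $\mathrm{MSet}(X)$ denotes the class of multisets of elements of $X$. A composition rule is a mapping $\blacktriangleleft\,:\mathcal{C}\times\mathcal{C}\to\mathrm{MSet}(\mathcal{C})$, extended to multisets by $A\blacktriangleleft B=\biguplus_{a\in A,\,b\in B}a\blacktriangleleft b$ (a single object being identified with a singleton multiset). A decomposition rule is a mapping $\langle\cdot\rangle:\mathcal{C}\to\mathrm{MSet}(\mathcal{C}\times\mathcal{C})$, extended to multisets by $\langle A\rangle=\biguplus_{a\in A}\langle a\rangle$. Conditions: (C1) $\Gamma_2\blacktriangleleft\Gamma_1$ is finite for all $\Gamma_2,\Gamma_1\in\mathcal{C}$. (C2) $\Gamma_3\blacktriangleleft(\Gamma_2\blacktriangleleft\Gamma_1)=(\Gamma_3\blacktriangleleft\Gamma_2)\blacktriangleleft\Gamma_1$ for all $\Gamma_3,\Gamma_2,\Gamma_1\in\mathcal{C}$. (C3) The neutral object $\text{\O}\in\mathcal{C}$ satisfies $\text{\O}\blacktriangleleft\Gamma=\{\Gamma\}=\Gamma\blacktriangleleft\text{\O}$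 for all $\Gamma\in\mathcal{C}$. (D1) $\langle\Gamma\rangle$ is finite for all $\Gamma\in\mathcal{C}$. (D2) $\biguplus_{(\Gamma'',\Gamma')\in\langle\Gamma\rangle}\{\Gamma''\}\times\langle\Gamma'\rangle=\biguplus_{(\Gamma'',\Gamma')\in\langle\Gamma\rangle}\langle\Gamma''\rangle\times\{\Gamma'\}$ as multisets of triples, for all $\Gamma\in\mathcal{C}$. (D3) The void object $\text{\O}\in\mathcal{C}$ satisfies $\langle\text{\O}\rangle=\{(\text{\O},\text{\O})\}$ and, for every $\Gamma\neq\text{\O}$, the pairs in $\langle\Gamma\rangle$ having a component equal to $\text{\O}$ or to $\Gamma$ are exactly $(\text{\O},\Gamma)$ and $(\Gamma,\text{\O})$, each with multiplicity one. (CD1) For all $\Gamma_2,\Gamma_1\in\mathcal{C}$, as multisets, $\langle\Gamma_2\blacktriangleleft\Gamma_1\rangle=\biguplus(\Gamma_2''\blacktriangleleft\Gamma_1'')\times(\Gamma_2'\blacktriangleleft\Gamma_1')$, the union being over $(\Gamma_2'',\Gamma_2')\in\langle\Gamma_2\rangle$ and $(\Gamma_1'',\Gamma_1')\in\langle\Gamma_1\rangle$. The neutral object of (C3) and the void object of (D3) are the same object, with common notation $\text{\O}$. Multiple decompositions: for $n\geq1$ the multiset of decompositions $\Gamma\leadsto(\Gamma_n,\dots,\Gamma_1)$ of $\Gamma$ into $n$ components is obtained by iterated decomposition: for $n=1$ it is $\{(\Gamma)\}$, for $n=2$ it is $\langle\Gamma\rangle$, and the decompositions into $n+1$ components are obtained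 from those into $n$ components by splitting one chosen component $\Gamma_i$ into a pair from $\langle\Gamma_i\rangle$ in all possible ways (with multiplicity); by (D2) the resulting multiset of $(n+1)$-tuples does not depend on which component is split. An antipode is a linear map $S:\mathscr{C}\to\mathscr{C}$ with $\mu\circ(\mathrm{Id}\otimes S)\circ\Delta=\epsilon=\mu\circ(S\otimes\mathrm{Id})\circ\Delta$, where $\mu(\Gamma_2\otimes\Gamma_1)=\Gamma_2*\Gamma_1$ and $\epsilon(x)=\varepsilon(x)\,\text{\O}$. *)

theory Defs
  imports Complex_Main "HOL-Library.Multiset" "HOL-Library.Poly_Mapping" "HOL-Library.Countable"
begin

section \<open>Composition and decomposition rules\<close>

definition mprod :: "'a multiset \<Rightarrow> 'b multiset \<Rightarrow> ('a \<times> 'b) multiset" where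
  "mprod A B = (\<Sum>a\<in>#A. {#(a, b). b \<in># B#})"

lemma count_mprod: "count (mprod A B) (a, b) = count A a * count B b"
proof -
  have pair: "count (image_mset (Pair x) B) (a, b) = (if x = a then count B b else 0)" for x
    by (induction B) auto
  show ?thesis
    unfolding mprod_def by (induction A) (auto simp: pair)
qed

text \<open>
  The objects of the combinatorial class are the elements of a type \<open>'c\<close>. Composition and
  decomposition rules take values in the library type of \<^emph>\<open>finite\<close> multisets, so the
  finiteness of every \<open>compos b a\<close> and of every \<open>dec a\<close> is part of the typing.
\<close>

definition comp_mset :: "('c \<Rightarrow> 'c \<Rightarrow> 'c multiset) \<Rightarrow> 'c multiset \<Rightarrow> 'c multiset \<Rightarrow> 'c multiset" where
  "comp_mset compos A B = (\<Sum>a\<in>#A. \<Sum>b\<in>#B. compos a b)"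

definition dec_mset :: "('c \<Rightarrow> ('c \<times> 'c) multiset) \<Rightarrow> 'c multiset \<Rightarrow> ('c \<times> 'c) multiset" where
  "dec_mset dec A = (\<Sum>a\<in>#A. dec a)"

definition reassoc :: "('a \<times> 'b) \<times> 'c \<Rightarrow> 'a \<times> ('b \<times> 'c)" where
  "reassoc = (\<lambda>((a, b), c). (a, (b, c)))"

locale comp_decomp_rules =
  fixes compos :: "'c \<Rightarrow> 'c \<Rightarrow> 'c multiset"
    and dec :: "'c \<Rightarrow> ('c \<times> 'c) multiset"
    and void :: 'c
  assumes C2: "comp_mset compos {#c#} (compos b a) = comp_mset compos (compos c b) {#a#}"
    and C3: "compos void a = {#a#}" "compos a void = {#a#}"
    and D2: "(\<Sum>(x, y)\<in>#dec a. mprod {#x#} (dec y)) =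
             image_mset reassoc (\<Sum>(x, y)\<in>#dec a. mprod (dec x) {#y#})"
    and D3_void: "dec void = {#(void, void)#}"
    and D3: "a \<noteq> void \<Longrightarrow>
             {#(x, y) \<in># dec a. x = void \<or> x = a \<or> y = void \<or> y = a#} = {#(void, a), (a, void)#}"
    and CD1: "dec_mset dec (compos b a) =
              (\<Sum>(b'', b')\<in>#dec b. \<Sum>(a'', a')\<in>#dec a. mprod (compos b'' a'') (compos b' a'))"


section \<open>Multiple decompositions\<close>

text \<open>
  A tuple \<open>(\<Gamma>\<^sub>n, \<dots>, \<Gamma>\<^sub>1)\<close> is the list with head \<open>\<Gamma>\<^sub>n\<close>. The definition always splits the head; the
  lemma \<open>decomps_split_at\<close> below shows that any other component may be split instead.
\<close>

definition split_at :: "('c \<Rightarrow> ('c \<times> 'c) multiset) \<Rightarrow> nat \<Rightarrow> 'c list \<Rightarrow> 'c list multiset" where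
  "split_at dec i xs = {#take i xs @ [x, y] @ drop (Suc i) xs. (x, y) \<in># dec (xs ! i)#}"

fun decomps :: "('c \<Rightarrow> ('c \<times> 'c) multiset) \<Rightarrow> nat \<Rightarrow> 'c \<Rightarrow> 'c list multiset" where
  "decomps dec 0 a = {#}"
| "decomps dec (Suc 0) a = {#[a]#}"
| "decomps dec (Suc (Suc n)) a = (\<Sum>xs\<in>#decomps dec (Suc n) a. split_at dec 0 xs)"

lemma length_decomps: "xs \<in># decomps dec n a \<Longrightarrow> length xs = n"
  by (induction dec n a arbitrary: xs rule: decomps.induct) (fastforce simp: split_at_def)+

lemma decomps_2: "decomps dec 2 a = {#[x, y]. (x, y) \<in># dec a#}"
  by (simp add: numeral_2_eq_2 split_at_def)

lemma image_mset_sum_mset: "image_mset f (\<Sum>x\<in>#A. g x) = (\<Sum>x\<in>#A. image_mset f (g x))"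
  by (induction A) auto

lemma sum_mset_image_sum_mset: "(\<Sum>z\<in>#(\<Sum>x\<in>#A. g x). f z) = (\<Sum>x\<in>#A. \<Sum>z\<in>#g x. f z)"
  by (induction A) auto

lemma sum_mset_image_swap:
  "(\<Sum>x\<in>#A. image_mset (f x) B) = (\<Sum>y\<in>#B. image_mset (\<lambda>x. f x y) A)"
proof -
  have "(\<Sum>x\<in>#A. image_mset (f x) B) = (\<Sum>x\<in>#A. \<Sum>y\<in>#B. {#f x y#})"
    by simp
  also have "\<dots> = (\<Sum>y\<in>#B. \<Sum>x\<in>#A. {#f x y#})"
    by (rule sum_mset.swap)
  also have "\<dots> = (\<Sum>y\<in>#B. image_mset (\<lambda>x. f x y) A)"
    by simp
  finally show ?thesis .
qed

context comp_decomp_rules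
begin

lemma split_at_1_split_at_0:
  "(\<Sum>ys\<in>#split_at dec 0 (a # xs). split_at dec 1 ys) =
   (\<Sum>ys\<in>#split_at dec 0 (a # xs). split_at dec 0 ys)"
proof -
  let ?f = "\<lambda>(x, (y, z)). x # y # z # xs"
  have "(\<Sum>ys\<in>#split_at dec 0 (a # xs). split_at dec 1 ys) =
      image_mset ?f (\<Sum>(x, y)\<in>#dec a. mprod {#x#} (dec y))"
    by (simp add: split_at_def image_mset_sum_mset mprod_def multiset.map_comp o_def case_prod_unfold)
  also have "\<dots> = image_mset ?f (image_mset reassoc (\<Sum>(x, y)\<in>#dec a. mprod (dec x) {#y#}))"
    by (simp only: D2)
  also have "\<dots> = (\<Sum>ys\<in>#split_at dec 0 (a # xs). split_at dec 0 ys)"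
    by (simp add: split_at_def image_mset_sum_mset mprod_def multiset.map_comp o_def
        case_prod_unfold reassoc_def)
  finally show ?thesis .
qed

lemma split_at_commute:
  assumes "0 < i" "i < length xs"
  shows "(\<Sum>ys\<in>#split_at dec 0 xs. split_at dec (Suc i) ys) =
         (\<Sum>ys\<in>#split_at dec i xs. split_at dec 0 ys)"
proof -
  obtain a zs j where [simp]: "xs = a # zs" "i = Suc j"
    using assms by (cases xs; cases i) auto
  show ?thesis
    by (simp add: split_at_def multiset.map_comp o_def case_prod_unfold)
      (rule sum_mset_image_swap)
qed

lemma decomps_split_at:
  "i < n \<Longrightarrow> decomps dec (Suc n) a = (\<Sum>xs\<in>#decomps dec n a. split_at dec i xs)"
proof (induction n arbitrary: i)
  case (Suc n)
  show ?case
  proof (cases "i = 0")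
    case False
    then obtain j where i: "i = Suc j" "j < n"
      using Suc.prems by (cases i) auto
    then obtain m where n: "n = Suc m"
      by (cases n) auto
    have dec_n: "decomps dec (Suc n) a = (\<Sum>xs\<in>#decomps dec n a. split_at dec 0 xs)"
      by (simp add: n)
    have "(\<Sum>xs\<in>#decomps dec (Suc n) a. split_at dec i xs) =
        (\<Sum>xs\<in>#decomps dec n a. \<Sum>ys\<in>#split_at dec 0 xs. split_at dec (Suc j) ys)"
      by (simp only: dec_n sum_mset_image_sum_mset i)
    also have "\<dots> = (\<Sum>xs\<in>#decomps dec n a. \<Sum>ys\<in>#split_at dec j xs. split_at dec 0 ys)"
    proof (rule arg_cong[where f = sum_mset], rule image_mset_cong)
      fix xs assume "xs \<in># decomps dec n a"
      then have len: "length xs = n"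
        by (rule length_decomps)
      show "(\<Sum>ys\<in>#split_at dec 0 xs. split_at dec (Suc j) ys) =
          (\<Sum>ys\<in>#split_at dec j xs. split_at dec 0 ys)"
      proof (cases "j = 0")
        case True
        then show ?thesis
          using len n split_at_1_split_at_0 by (cases xs) auto
      next
        case False
        then show ?thesis
          using len i(2) split_at_commute by simp
      qed
    qed
    also have "\<dots> = (\<Sum>xs\<in>#decomps dec (Suc n) a. split_at dec 0 xs)"
      by (simp only: Suc.IH[OF i(2)] sum_mset_image_sum_mset)
    finally show ?thesis
      by simp
  qed simp
qed simp

end


section \<open>Vector spaces with a basis\<close>

text \<open>
  The vector space over \<open>'k\<close> with basis \<open>'a\<close> is the type \<open>'a \<Rightarrow>\<^sub>0 'k\<close> of finitely supported functions.
  The tensor product of \<open>'a \<Rightarrow>\<^sub>0 'k\<close> and \<open>'b \<Rightarrow>\<^sub>0 'k\<close> is \<open>('a \<times> 'b) \<Rightarrow>\<^sub>0 'k\<close>, with basis the tensors of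
  basis elements.
\<close>

definition scal :: "'k::field \<Rightarrow> ('a \<Rightarrow>\<^sub>0 'k) \<Rightarrow> 'a \<Rightarrow>\<^sub>0 'k" where
  "scal c x = Poly_Mapping.map ((*) c) x"

definition basis :: "'a \<Rightarrow> 'a \<Rightarrow>\<^sub>0 'k::field" where
  "basis a = Poly_Mapping.single a 1"

definition lin_ext :: "('a \<Rightarrow> 'b \<Rightarrow>\<^sub>0 'k::field) \<Rightarrow> ('a \<Rightarrow>\<^sub>0 'k) \<Rightarrow> 'b \<Rightarrow>\<^sub>0 'k" where
  "lin_ext f x = (\<Sum>a\<in>Poly_Mapping.keys x. scal (Poly_Mapping.lookup x a) (f a))"

abbreviation linear_map :: "(('a \<Rightarrow>\<^sub>0 'k::field) \<Rightarrow> 'b \<Rightarrow>\<^sub>0 'k) \<Rightarrow> bool" where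
  "linear_map \<equiv> Vector_Spaces.linear scal scal"

abbreviation linear_form :: "(('a \<Rightarrow>\<^sub>0 'k::field) \<Rightarrow> 'k) \<Rightarrow> bool" where
  "linear_form \<equiv> Vector_Spaces.linear scal (*)"

definition tensor :: "('a \<Rightarrow>\<^sub>0 'k::field) \<Rightarrow> ('b \<Rightarrow>\<^sub>0 'k) \<Rightarrow> ('a \<times> 'b) \<Rightarrow>\<^sub>0 'k" where
  "tensor x y = (\<Sum>a\<in>Poly_Mapping.keys x. \<Sum>b\<in>Poly_Mapping.keys y. scal (Poly_Mapping.lookup x a * Poly_Mapping.lookup y b) (basis (a, b)))"

definition tensor_map ::
    "(('a \<Rightarrow>\<^sub>0 'k::field) \<Rightarrow> 'b \<Rightarrow>\<^sub>0 'k) \<Rightarrow> (('c \<Rightarrow>\<^sub>0 'k) \<Rightarrow> 'd \<Rightarrow>\<^sub>0 'k) \<Rightarrow>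
     (('a \<times> 'c) \<Rightarrow>\<^sub>0 'k) \<Rightarrow> ('b \<times> 'd) \<Rightarrow>\<^sub>0 'k" where
  "tensor_map f g = lin_ext (\<lambda>(a, c). tensor (f (basis a)) (g (basis c)))"

lemma lookup_scal: "Poly_Mapping.lookup (scal c x) a = c * Poly_Mapping.lookup x a"
  unfolding scal_def by transfer (simp add: when_def)

lemma vector_space_scal: "vector_space (scal :: 'k::field \<Rightarrow> ('a \<Rightarrow>\<^sub>0 'k) \<Rightarrow> 'a \<Rightarrow>\<^sub>0 'k)"
  by unfold_locales (auto intro!: poly_mapping_eqI simp: lookup_scal lookup_add algebra_simps)

lemma lin_ext_basis: "lin_ext f (basis a) = f a"
  by (auto intro!: poly_mapping_eqI simp: lin_ext_def basis_def lookup_scal)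

lemma lin_ext_superset:
  assumes "finite A" "Poly_Mapping.keys x \<subseteq> A"
  shows "lin_ext f x = (\<Sum>a\<in>A. scal (Poly_Mapping.lookup x a) (f a))"
proof -
  have "scal (Poly_Mapping.lookup x a) (f a) = 0" if "a \<notin> Poly_Mapping.keys x" for a
    using that by (auto intro!: poly_mapping_eqI simp: lookup_scal in_keys_iff)
  then show ?thesis
    unfolding lin_ext_def using assms by (intro sum.mono_neutral_left) auto
qed

lemma linear_lin_ext: "linear_map (lin_ext f)"
proof -
  interpret s: vector_space "scal :: 'a \<Rightarrow> ('b \<Rightarrow>\<^sub>0 'a) \<Rightarrow> _" by (rule vector_space_scal)
  interpret t: vector_space "scal :: 'a \<Rightarrow> ('c \<Rightarrow>\<^sub>0 'a) \<Rightarrow> _" by (rule vector_space_scal)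
  show ?thesis
  proof
    fix x y :: "'b \<Rightarrow>\<^sub>0 'a"
    let ?A = "Poly_Mapping.keys x \<union> Poly_Mapping.keys y"
    show "lin_ext f (x + y) = lin_ext f x + lin_ext f y"
      using keys_add[of x y]
      by (simp add: lin_ext_superset[of ?A] lookup_add t.scale_left_distrib sum.distrib)
  next
    fix c and x :: "'b \<Rightarrow>\<^sub>0 'a"
    have "Poly_Mapping.keys (scal c x) \<subseteq> Poly_Mapping.keys x"
      by (auto simp: in_keys_iff lookup_scal)
    then show "lin_ext f (scal c x) = scal c (lin_ext f x)"
      by (simp add: lin_ext_superset[of "Poly_Mapping.keys x"] lookup_scal t.scale_sum_right)
  qed
qed


section \<open>Bialgebras and Hopf algebras\<close>

definition mul_map ::
    "(('a \<Rightarrow>\<^sub>0 'k::field) \<Rightarrow> ('a \<Rightarrow>\<^sub>0 'k) \<Rightarrow> 'a \<Rightarrow>\<^sub>0 'k) \<Rightarrow> (('a \<times> 'a) \<Rightarrow>\<^sub>0 'k) \<Rightarrow> 'a \<Rightarrow>\<^sub>0 'k" where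
  "mul_map mul = lin_ext (\<lambda>(b, a). mul (basis b) (basis a))"

text \<open>The product \<open>(x \<otimes> y) (z \<otimes> w) = xz \<otimes> yw\<close> of the tensor square:\<close>

definition tensor_mul ::
    "(('a \<Rightarrow>\<^sub>0 'k::field) \<Rightarrow> ('a \<Rightarrow>\<^sub>0 'k) \<Rightarrow> 'a \<Rightarrow>\<^sub>0 'k) \<Rightarrow>
     (('a \<times> 'a) \<Rightarrow>\<^sub>0 'k) \<Rightarrow> (('a \<times> 'a) \<Rightarrow>\<^sub>0 'k) \<Rightarrow> ('a \<times> 'a) \<Rightarrow>\<^sub>0 'k" where
  "tensor_mul mul s t =
     lin_ext (\<lambda>((b'', b'), (a'', a')).
       tensor (mul (basis b'') (basis a'')) (mul (basis b') (basis a'))) (tensor s t)"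

text \<open>
  In the counit laws, \<open>\<epsilon> \<otimes> Id\<close> and \<open>Id \<otimes> \<epsilon>\<close> are composed with the identifications of
  \<open>K \<otimes> V\<close> and \<open>V \<otimes> K\<close> with \<open>V\<close>.
\<close>

locale bialgebra =
  fixes mul :: "('a \<Rightarrow>\<^sub>0 'k::field) \<Rightarrow> ('a \<Rightarrow>\<^sub>0 'k) \<Rightarrow> 'a \<Rightarrow>\<^sub>0 'k"
    and unit :: "'a \<Rightarrow>\<^sub>0 'k"
    and \<Delta> :: "('a \<Rightarrow>\<^sub>0 'k) \<Rightarrow> ('a \<times> 'a) \<Rightarrow>\<^sub>0 'k"
    and \<epsilon> :: "('a \<Rightarrow>\<^sub>0 'k) \<Rightarrow> 'k"
  assumes mul_linear_right: "linear_map (mul x)"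
    and mul_linear_left: "linear_map (\<lambda>x. mul x y)"
    and mul_assoc: "mul (mul x y) z = mul x (mul y z)"
    and unit_left: "mul unit x = x"
    and unit_right: "mul x unit = x"
    and comult_linear: "linear_map \<Delta>"
    and counit_linear: "linear_form \<epsilon>"
    and coassoc: "tensor_map id \<Delta> (\<Delta> x) =
                  lin_ext (\<lambda>t. basis (reassoc t)) (tensor_map \<Delta> id (\<Delta> x))"
    and counit_left: "lin_ext (\<lambda>(a, b). scal (\<epsilon> (basis a)) (basis b)) (\<Delta> x) = x"
    and counit_right: "lin_ext (\<lambda>(a, b). scal (\<epsilon> (basis b)) (basis a)) (\<Delta> x) = x"
    and comult_mul: "\<Delta> (mul x y) = tensor_mul mul (\<Delta> x) (\<Delta> y)"
    and comult_unit: "\<Delta> unit = tensor unit unit"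
    and counit_mul: "\<epsilon> (mul x y) = \<epsilon> x * \<epsilon> y"
    and counit_unit: "\<epsilon> unit = 1"

locale hopf_algebra = bialgebra mul unit \<Delta> \<epsilon>
  for mul :: "('a \<Rightarrow>\<^sub>0 'k::field) \<Rightarrow> ('a \<Rightarrow>\<^sub>0 'k) \<Rightarrow> 'a \<Rightarrow>\<^sub>0 'k"
    and unit :: "'a \<Rightarrow>\<^sub>0 'k"
    and \<Delta> :: "('a \<Rightarrow>\<^sub>0 'k) \<Rightarrow> ('a \<times> 'a) \<Rightarrow>\<^sub>0 'k"
    and \<epsilon> :: "('a \<Rightarrow>\<^sub>0 'k) \<Rightarrow> 'k" +
  fixes S :: "('a \<Rightarrow>\<^sub>0 'k) \<Rightarrow> 'a \<Rightarrow>\<^sub>0 'k"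
  assumes antipode_linear: "linear_map S"
    and antipode_right: "mul_map mul (tensor_map id S (\<Delta> x)) = scal (\<epsilon> x) unit"
    and antipode_left: "mul_map mul (tensor_map S id (\<Delta> x)) = scal (\<epsilon> x) unit"


section \<open>The structure maps given by a composition and a decomposition rule\<close>

definition comp_mult ::
    "('c \<Rightarrow> 'c \<Rightarrow> 'c multiset) \<Rightarrow> ('c \<Rightarrow>\<^sub>0 'k::field) \<Rightarrow> ('c \<Rightarrow>\<^sub>0 'k) \<Rightarrow> 'c \<Rightarrow>\<^sub>0 'k" where
  "comp_mult compos x y = lin_ext (\<lambda>(b, a). \<Sum>c\<in>#compos b a. basis c) (tensor x y)"

definition dec_comult ::
    "('c \<Rightarrow> ('c \<times> 'c) multiset) \<Rightarrow> ('c \<Rightarrow>\<^sub>0 'k::field) \<Rightarrow> ('c \<times> 'c) \<Rightarrow>\<^sub>0 'k" where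
  "dec_comult dec = lin_ext (\<lambda>a. \<Sum>(a'', a')\<in>#dec a. tensor (basis a'') (basis a'))"

definition void_counit :: "'c \<Rightarrow> ('c \<Rightarrow>\<^sub>0 'k::field) \<Rightarrow> 'k" where
  "void_counit void x = (\<Sum>a\<in>Poly_Mapping.keys x. Poly_Mapping.lookup x a * (if a = void then 1 else 0))"

definition nonvoid_decomps :: "('c \<Rightarrow> ('c \<times> 'c) multiset) \<Rightarrow> 'c \<Rightarrow> nat \<Rightarrow> 'c \<Rightarrow> 'c list multiset" where
  "nonvoid_decomps dec void n a = {#xs \<in># decomps dec n a. void \<notin> set xs#}"

text \<open>
  In \<open>antipode\<close>, the outer sum runs over the \<open>n\<close> for which there are any summands; \<open>n = 0\<close> is not among
  them, because \<open>decomps dec 0 a\<close> is empty.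
\<close>

definition antipode ::
    "('c \<Rightarrow> 'c \<Rightarrow> 'c multiset) \<Rightarrow> ('c \<Rightarrow> ('c \<times> 'c) multiset) \<Rightarrow> 'c \<Rightarrow> ('c \<Rightarrow>\<^sub>0 'k::field) \<Rightarrow> 'c \<Rightarrow>\<^sub>0 'k" where
  "antipode compos dec void = lin_ext (\<lambda>a.
     if a = void then basis void
     else \<Sum>n | nonvoid_decomps dec void n a \<noteq> {#}. \<Sum>xs\<in>#nonvoid_decomps dec void n a.
            scal ((-1) ^ n) (foldr (comp_mult compos) (map basis xs) (basis void)))"

end

theory Submission
  imports Defs
begin

text \<open>
  The bialgebra axioms are linear in each argument, so it suffices to check them on basis elements,
  and there each of them is the image of an identity of multisets under the map
  \<open>mset_vector\<close>, which sends a multiset to the sum of its elements. Associativity comes from (C2),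
  coassociativity from (D2), the (co)unit laws from (C3) and (D3), and compatibility of product and
  coproduct from (CD1). Only multiplicativity of the counit is not the translation of an axiom: it
  says that \<open>void\<close> does not occur in \<open>compos b a\<close> unless \<open>a = b = void\<close>. This follows by counting the
  pair \<open>(void, void)\<close> on both sides of (CD1) in \<open>void_in_compos\<close>.

  For the antipode, consider the convolution product \<open>(f \<star> g) a = \<Sum> f x \<odot> g y\<close>, summed over the
  pairs \<open>(x, y)\<close> in \<open>dec a\<close>, whose neutral element is \<open>e = unit \<circ> \<epsilon>\<close>. Write \<open>id = e + J\<close>, where \<open>J\<close>
  kills \<open>void\<close> and fixes the other basis elements. An inverse of \<open>id\<close> is then the geometric series
  \<open>\<Sum>n. (-1)\<^sup>n J\<^sup>\<star>\<^sup>n\<close>. Unfolding the iterated convolution shows that \<open>J\<^sup>\<star>\<^sup>n a\<close> is the sum of the products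
  of all decompositions of \<open>a\<close> into \<open>n\<close> components different from \<open>void\<close>; so the series is \<open>S\<close>, and by
  hypothesis it is a finite sum at each \<open>a\<close>. As \<open>id \<star> J\<^sup>\<star>\<^sup>n = J\<^sup>\<star>\<^sup>n + J\<^sup>\<star>\<^sup>n\<^sup>+\<^sup>1 = J\<^sup>\<star>\<^sup>n \<star> id\<close>, both \<open>id \<star> S\<close>
  and \<open>S \<star> id\<close> telescope to \<open>e\<close>. That \<open>J\<^sup>\<star>\<^sup>n\<^sup>+\<^sup>1\<close> is both \<open>J \<star> J\<^sup>\<star>\<^sup>n\<close> and \<open>J\<^sup>\<star>\<^sup>n \<star> J\<close> is read off
  from the decompositions themselves: those into \<open>n + 1\<close> components arise by decomposing either
  component of a pair in \<open>dec a\<close> into \<open>n\<close> components (\<open>decomps_Suc_Suc_head\<close>, \<open>decomps_Suc_Suc_last\<close>).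
\<close>

section \<open>Linear algebra on a space with a basis\<close>

interpretation scal: vector_space "scal :: 'k::field \<Rightarrow> ('a \<Rightarrow>\<^sub>0 'k) \<Rightarrow> 'a \<Rightarrow>\<^sub>0 'k"
  by (rule vector_space_scal)

text \<open>
  Equations between linear expressions are proved by this rule, one argument after the other: the
  cases \<open>zero\<close>, \<open>add\<close> and \<open>scal\<close> are linearity, and only \<open>basis\<close> has content.
\<close>

lemma basis_induct [case_names basis zero add scal]:
  fixes x :: "'a \<Rightarrow>\<^sub>0 'k::field"
  assumes basis: "\<And>a. P (basis a)"
    and zero: "P 0"
    and add: "\<And>x y. P x \<Longrightarrow> P y \<Longrightarrow> P (x + y)"
    and scal: "\<And>c x. P x \<Longrightarrow> P (scal c x)"
  shows "P x"
proof -
  have "lin_ext basis x = x"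
    by (auto intro!: poly_mapping_eqI
        simp: lin_ext_def lookup_sum lookup_scal basis_def lookup_single when_def in_keys_iff if_distrib[of "(*) _"] cong: if_cong)
  moreover have "P (\<Sum>a\<in>A. scal (Poly_Mapping.lookup x a) (basis a))" if "finite A" for A
    using that by (induction A rule: finite_induct) (auto intro: assms)
  ultimately show ?thesis
    by (metis lin_ext_def finite_keys)
qed

lemma linear_mapI:
  assumes "\<And>x y. f (x + y) = f x + f y" and "\<And>c x. f (scal c x) = scal c (f x)"
  shows "linear_map f"
  by unfold_locales (simp_all add: assms)

lemma lin_ext_add [simp]: "lin_ext f (x + y) = lin_ext f x + lin_ext f y"
  and lin_ext_scal [simp]: "lin_ext f (scal c x) = scal c (lin_ext f x)"
  using linear_lin_ext[of f] by (simp_all add: Vector_Spaces.linear_iff)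

lemma lin_ext_zero [simp]: "lin_ext f 0 = 0"
  by (simp add: lin_ext_def)

lemma lin_ext_sum_mset: "lin_ext f (\<Sum>a\<in>#A. g a) = (\<Sum>a\<in>#A. lin_ext f (g a))"
  by (induction A) auto

lemma scal_sum_mset: "scal c (\<Sum>a\<in>#A. g a) = (\<Sum>a\<in>#A. scal c (g a))"
  by (induction A) (auto simp: scal.scale_right_distrib)

lemma lin_ext_pointwise_add: "lin_ext (\<lambda>a. f a + g a) x = lin_ext f x + lin_ext g x"
  by (simp add: lin_ext_def scal.scale_right_distrib sum.distrib)

lemma lin_ext_pointwise_scal: "lin_ext (\<lambda>a. scal c (f a)) x = scal c (lin_ext f x)"
  by (simp add: lin_ext_def scal.scale_sum_right mult.commute)

text \<open>
  This form makes bilinearity of \<open>tensor\<close> an instance of linearity of \<open>lin_ext\<close>, in its vector argument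
  and in its function argument.
\<close>

lemma tensor_eq_lin_ext: "tensor x y = lin_ext (\<lambda>a. lin_ext (\<lambda>b. basis (a, b)) y) x"
  by (simp add: tensor_def lin_ext_def scal.scale_sum_right)

lemma tensor_bilinear [simp]:
  "tensor (x + x') y = tensor x y + tensor x' y"
  "tensor (scal c x) y = scal c (tensor x y)"
  "tensor 0 y = 0"
  "tensor x (y + y') = tensor x y + tensor x y'"
  "tensor x (scal c y) = scal c (tensor x y)"
  "tensor x 0 = 0"
  by (simp_all add: tensor_eq_lin_ext lin_ext_pointwise_add lin_ext_pointwise_scal)
    (simp add: lin_ext_def)

lemma tensor_basis: "tensor (basis a) (basis b) = basis (a, b)"
  by (simp add: tensor_eq_lin_ext lin_ext_basis)

lemma void_counit_eq_lookup: "void_counit void x = Poly_Mapping.lookup x void"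
  by (simp add: void_counit_def in_keys_iff if_distrib[of "(*) _"] cong: if_cong)

text \<open>
  This map carries identities of multisets to identities of vectors. In characteristic \<open>p\<close> it reduces
  multiplicities modulo \<open>p\<close>, so arguments that compare multiplicities have to be made for multisets.
\<close>

definition mset_vector :: "'a multiset \<Rightarrow> 'a \<Rightarrow>\<^sub>0 'k::field" where
  "mset_vector A = (\<Sum>a\<in>#A. basis a)"

lemma mset_vector_empty [simp]: "mset_vector {#} = 0"
  and mset_vector_add_mset [simp]: "mset_vector (add_mset a A) = basis a + mset_vector A"
  and mset_vector_plus [simp]: "mset_vector (A + B) = mset_vector A + mset_vector B"
  by (simp_all add: mset_vector_def)

lemma mset_vector_sum_mset: "mset_vector (\<Sum>a\<in>#A. g a) = (\<Sum>a\<in>#A. mset_vector (g a))"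
  by (induction A) auto

lemma lin_ext_mset_vector: "lin_ext f (mset_vector A) = (\<Sum>a\<in>#A. f a)"
  by (simp add: mset_vector_def lin_ext_sum_mset lin_ext_basis)

lemma tensor_mset_vector:
  "tensor (mset_vector A) (mset_vector B) = (mset_vector (mprod A B) :: ('a \<times> 'b) \<Rightarrow>\<^sub>0 'k::field)"
proof -
  have "tensor (basis a) (mset_vector B :: 'b \<Rightarrow>\<^sub>0 'k) = mset_vector (image_mset (Pair a) B)" for a :: 'a
    by (induction B) (auto simp: tensor_basis)
  then show ?thesis
    by (induction A) (auto simp: mprod_def)
qed

lemma lookup_mset_vector: "Poly_Mapping.lookup (mset_vector A) a = of_nat (count A a)"
  by (induction A) (auto simp: lookup_add basis_def lookup_single)

lemma sum_mset_mprod: "(\<Sum>p\<in>#mprod A B. f p) = (\<Sum>a\<in>#A. \<Sum>b\<in>#B. f (a, b))"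
  unfolding mprod_def by (induction A) (auto simp: multiset.map_comp o_def)


section \<open>The bialgebra of a composition and a decomposition rule\<close>

lemma comp_mult_bilinear [simp]:
  "comp_mult compos (x + x') y = comp_mult compos x y + comp_mult compos x' y"
  "comp_mult compos (scal c x) y = scal c (comp_mult compos x y)"
  "comp_mult compos 0 y = 0"
  "comp_mult compos x (y + y') = comp_mult compos x y + comp_mult compos x y'"
  "comp_mult compos x (scal c y) = scal c (comp_mult compos x y)"
  "comp_mult compos x 0 = 0"
  by (simp_all add: comp_mult_def)

lemma comp_mult_sum_mset:
  "comp_mult compos (\<Sum>a\<in>#A. f a) y = (\<Sum>a\<in>#A. comp_mult compos (f a) y)"
  "comp_mult compos x (\<Sum>a\<in>#A. f a) = (\<Sum>a\<in>#A. comp_mult compos x (f a))"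
  by (induction A) auto

lemma comp_mult_sum:
  "comp_mult compos (\<Sum>i\<in>I. f i) y = (\<Sum>i\<in>I. comp_mult compos (f i) y)"
  "comp_mult compos x (\<Sum>i\<in>I. f i) = (\<Sum>i\<in>I. comp_mult compos x (f i))"
  by (induction I rule: infinite_finite_induct) auto

lemma comp_mult_mset_vector:
  "comp_mult compos (mset_vector A) (mset_vector B) = mset_vector (comp_mset compos A B)"
  by (simp add: comp_mult_def tensor_mset_vector lin_ext_mset_vector sum_mset_mprod comp_mset_def
      mset_vector_sum_mset flip: mset_vector_def)

lemma basis_eq_mset_vector: "basis a = mset_vector {#a#}"
  by simp

lemma comp_mult_basis: "comp_mult compos (basis b) (basis a) = mset_vector (compos b a)"
  by (simp add: comp_mult_mset_vector comp_mset_def del: mset_vector_add_mset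
      add: basis_eq_mset_vector)

lemma mul_map_comp_mult_tensor: "mul_map (comp_mult compos) (tensor x y) = comp_mult compos x y"
  by (simp add: mul_map_def comp_mult_basis)
    (simp add: comp_mult_def mset_vector_def)

lemma dec_comult_basis: "dec_comult dec (basis a) = mset_vector (dec a)"
  by (simp add: dec_comult_def lin_ext_basis tensor_basis mset_vector_def case_prod_unfold)

lemma dec_comult_linear [simp]:
  "dec_comult dec (x + y) = dec_comult dec x + dec_comult dec y"
  "dec_comult dec (scal c x) = scal c (dec_comult dec x)"
  "dec_comult dec 0 = 0"
  by (simp_all add: dec_comult_def)

lemma dec_comult_mset_vector: "dec_comult dec (mset_vector A) = mset_vector (dec_mset dec A)"
  by (induction A) (auto simp: dec_mset_def dec_comult_basis)

context comp_decomp_rules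
begin

text \<open>
  For \<open>a \<noteq> void\<close> this is the part of (D3) that concerns the first component; the statement also covers
  \<open>a = void\<close>, where the two pairs of (D3) collapse to one. It is the counit law for multisets.
\<close>

lemma filter_dec_left_void: "{#p \<in># dec a. fst p = void#} = {#(void, a)#}"
proof (cases "a = void")
  case False
  have "{#p \<in># dec a. fst p = void#} =
      {#p \<in># {#(x, y) \<in># dec a. x = void \<or> x = a \<or> y = void \<or> y = a#}. fst p = void#}"
    by (auto simp: filter_filter_mset intro!: filter_mset_cong)
  then show ?thesis
    using False by (simp add: D3)
qed (simp add: D3_void)

lemma filter_dec_right_void: "{#p \<in># dec a. snd p = void#} = {#(a, void)#}"
proof (cases "a = void")
  case False
  have "{#p \<in># dec a. snd p = void#} =
      {#p \<in># {#(x, y) \<in># dec a. x = void \<or> x = a \<or> y = void \<or> y = a#}. snd p = void#}"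
    by (auto simp: filter_filter_mset intro!: filter_mset_cong)
  then show ?thesis
    using False by (simp add: D3)
qed (simp add: D3_void)

text \<open>In terms of convolution: \<open>e \<star> f = f\<close>, and \<open>f \<star> e = f\<close> in the next lemma.\<close>

lemma sum_dec_left_void:
  "(\<Sum>(x, y)\<in>#dec a. if x = void then f y else 0) = (f a :: 'b::comm_monoid_add)"
proof -
  have "(\<Sum>(x, y)\<in>#A. if x = void then f y else 0) = (\<Sum>p\<in>#{#p \<in># A. fst p = void#}. f (snd p))"
    for A :: "('c \<times> 'c) multiset"
    by (induction A) auto
  then show ?thesis
    by (simp add: filter_dec_left_void)
qed

lemma sum_dec_right_void:
  "(\<Sum>(x, y)\<in>#dec a. if y = void then f x else 0) = (f a :: 'b::comm_monoid_add)"
proof -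
  have "(\<Sum>(x, y)\<in>#A. if y = void then f x else 0) = (\<Sum>p\<in>#{#p \<in># A. snd p = void#}. f (fst p))"
    for A :: "('c \<times> 'c) multiset"
    by (induction A) auto
  then show ?thesis
    by (simp add: filter_dec_right_void)
qed

lemma count_dec_void_void: "count (dec c) (void, void) = (if c = void then 1 else 0)"
proof -
  have "count (dec c) (void, void) = count {#p \<in># dec c. fst p = void#} (void, void)"
    by simp
  then show ?thesis
    by (simp add: filter_dec_left_void)
qed

lemma count_dec_mset_void_void: "count (dec_mset dec A) (void, void) = count A void"
  by (induction A) (auto simp: dec_mset_def count_dec_void_void)

text \<open>
  Let \<open>m\<close> be the multiplicity of \<open>void\<close> in \<open>compos b a\<close> for \<open>a, b \<noteq> void\<close>. As \<open>void\<close> is the only object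
  whose decompositions contain \<open>(void, void)\<close>, this pair has multiplicity \<open>m\<close> on the left of (CD1). On
  the right, the choices \<open>(void, b), (void, a)\<close> and \<open>(b, void), (a, void)\<close> already contribute \<open>m\<close>
  each. Hence \<open>2 * m \<le> m\<close>.
\<close>

lemma void_in_compos: "count (compos b a) void = (if b = void \<and> a = void then 1 else 0)"
proof (cases "b = void \<or> a = void")
  case True
  then show ?thesis
    by (auto simp: C3)
next
  case False
  define m where "m = count (compos b a) void"
  define A where "A c = {#(x, y) \<in># dec c. x = void \<or> x = c \<or> y = void \<or> y = c#}" for c
  let ?f = "\<lambda>p q. count (compos (fst p) (fst q)) void * count (compos (snd p) (snd q)) void"
  have count_sum: "count (\<Sum>p\<in>#D. g p) z = (\<Sum>p\<in>#D. count (g p) z)"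
    for D :: "('c \<times> 'c) multiset" and g :: "_ \<Rightarrow> ('c \<times> 'c) multiset" and z
    by (induction D) auto
  have mono: "(\<Sum>p\<in>#filter_mset P D. g p) \<le> (\<Sum>p\<in>#D. g p)"
    for P and D :: "('c \<times> 'c) multiset" and g :: "_ \<Rightarrow> nat"
    by (induction D) auto
  have "m = count (dec_mset dec (compos b a)) (void, void)"
    by (simp add: m_def count_dec_mset_void_void)
  also have "\<dots> = (\<Sum>p\<in>#dec b. \<Sum>q\<in>#dec a. ?f p q)"
    by (simp add: CD1 count_sum case_prod_unfold count_mprod)
  also have "\<dots> \<ge> (\<Sum>p\<in>#A b. \<Sum>q\<in>#A a. ?f p q)"
  proof -
    have "(\<Sum>p\<in>#A b. \<Sum>q\<in>#A a. ?f p q) \<le> (\<Sum>p\<in>#dec b. \<Sum>q\<in>#A a. ?f p q)"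
      unfolding A_def by (rule mono)
    also have "\<dots> \<le> (\<Sum>p\<in>#dec b. \<Sum>q\<in>#dec a. ?f p q)"
      unfolding A_def by (intro sum_mset_mono mono)
    finally show ?thesis .
  qed
  \<comment> \<open>the mixed choices \<open>(void, b), (a, void)\<close> and \<open>(b, void), (void, a)\<close> contribute nothing, by (C3)\<close>
  moreover have "(\<Sum>p\<in>#A b. \<Sum>q\<in>#A a. ?f p q) = 2 * m"
    using False by (simp add: A_def D3 C3 m_def)
  ultimately have "m = 0"
    by linarith
  with False show ?thesis
    by (simp add: m_def)
qed

lemma comp_mult_assoc:
  "comp_mult compos (comp_mult compos x y) z = comp_mult compos x (comp_mult compos y z)"
proof (induction x rule: basis_induct)
  case (basis c)
  show ?case
  proof (induction y rule: basis_induct)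
    case (basis b)
    show ?case
    proof (induction z rule: basis_induct)
      case (basis a)
      show ?case
        unfolding basis_eq_mset_vector comp_mult_mset_vector
        using C2[of c b a] by (simp add: comp_mset_def)
    qed simp_all
  qed simp_all
qed simp_all

lemma comp_mult_void_left: "comp_mult compos (basis void) x = x"
  by (induction x rule: basis_induct) (simp_all add: comp_mult_basis C3)

lemma comp_mult_void_right: "comp_mult compos x (basis void) = x"
  by (induction x rule: basis_induct) (simp_all add: comp_mult_basis C3)

lemma dec_comult_coassoc:
  "tensor_map id (dec_comult dec) (dec_comult dec x) =
   lin_ext (\<lambda>t. basis (reassoc t)) (tensor_map (dec_comult dec) id (dec_comult dec x))"
proof (induction x rule: basis_induct)
  case (basis a)
  have "tensor_map id (dec_comult dec) (dec_comult dec (basis a)) =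
      mset_vector (\<Sum>(x, y)\<in>#dec a. mprod {#x#} (dec y))"
    by (simp add: dec_comult_basis tensor_map_def lin_ext_mset_vector mset_vector_sum_mset
        case_prod_unfold tensor_mset_vector[symmetric])
  also have "\<dots> = mset_vector (image_mset reassoc (\<Sum>(x, y)\<in>#dec a. mprod (dec x) {#y#}))"
    by (simp only: D2)
  also have "\<dots> = lin_ext (\<lambda>t. basis (reassoc t))
      (mset_vector (\<Sum>(x, y)\<in>#dec a. mprod (dec x) {#y#}))"
    by (simp add: lin_ext_mset_vector) (simp add: mset_vector_def multiset.map_comp o_def)
  also have "mset_vector (\<Sum>(x, y)\<in>#dec a. mprod (dec x) {#y#}) =
      tensor_map (dec_comult dec) id (dec_comult dec (basis a))"
    by (simp add: dec_comult_basis tensor_map_def lin_ext_mset_vector mset_vector_sum_mset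
        case_prod_unfold tensor_mset_vector[symmetric])
  finally show ?case .
qed (simp_all add: tensor_map_def)

lemma dec_comult_comp_mult:
  "dec_comult dec (comp_mult compos x y) =
   tensor_mul (comp_mult compos) (dec_comult dec x) (dec_comult dec y)"
proof (induction x rule: basis_induct)
  case (basis b)
  show ?case
  proof (induction y rule: basis_induct)
    case (basis a)
    show ?case
      by (simp add: comp_mult_basis dec_comult_mset_vector CD1 dec_comult_basis tensor_mul_def
          tensor_mset_vector lin_ext_mset_vector sum_mset_mprod mset_vector_sum_mset
          case_prod_unfold)
  qed (simp_all add: tensor_mul_def)
qed (simp_all add: tensor_mul_def)

lemma void_counit_comp_mult:
  "void_counit void (comp_mult compos x y) =
   void_counit void x * (void_counit void y :: 'k::field)"
proof (induction x rule: basis_induct)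
  case (basis b)
  show ?case
  proof (induction y rule: basis_induct)
    case (basis a)
    show ?case
      by (simp add: comp_mult_basis void_counit_eq_lookup lookup_mset_vector void_in_compos)
        (simp add: basis_def lookup_single when_def)
  qed (simp_all add: void_counit_eq_lookup lookup_add lookup_scal algebra_simps)
qed (simp_all add: void_counit_eq_lookup lookup_add lookup_scal algebra_simps)

lemma void_counit_basis: "void_counit void (basis a) = (if a = void then 1 else 0)"
  by (simp add: void_counit_eq_lookup basis_def lookup_single when_def)

lemma dec_comult_counit:
  shows "lin_ext (\<lambda>(a, b). scal (void_counit void (basis a)) (basis b)) (dec_comult dec x) = x"
    (is "lin_ext ?l _ = x")
    and "lin_ext (\<lambda>(a, b). scal (void_counit void (basis b)) (basis a)) (dec_comult dec x) = x"
    (is "lin_ext ?r _ = x")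
proof -
  have "?l = (\<lambda>(a, b). if a = void then basis b else 0)"
    "?r = (\<lambda>(a, b). if b = void then basis a else 0)"
    by (auto simp: void_counit_basis)
  then show "lin_ext ?l (dec_comult dec x) = x" "lin_ext ?r (dec_comult dec x) = x"
    by (induction x rule: basis_induct; simp add: dec_comult_basis lin_ext_mset_vector
        sum_dec_left_void sum_dec_right_void)+
qed

lemma linear_void_counit: "linear_form (void_counit void)"
  by unfold_locales (simp_all add: void_counit_eq_lookup lookup_add lookup_scal algebra_simps)

theorem bialgebra_comp_dec:
  "bialgebra (comp_mult compos) (basis void :: 'c \<Rightarrow>\<^sub>0 'k::field) (dec_comult dec) (void_counit void)"
  by (intro bialgebra.intro linear_mapI linear_void_counit comp_mult_assoc comp_mult_void_left
      comp_mult_void_right dec_comult_coassoc dec_comult_counit dec_comult_comp_mult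
      void_counit_comp_mult)
    (simp_all add: dec_comult_basis D3_void tensor_basis void_counit_basis)


section \<open>The antipode as a geometric series\<close>

text \<open>
  Multiple decompositions are generated by splitting the head, which here would touch the component \<open>x\<close>
  that is to be kept. The induction instead splits the component at position 1, the head of the
  decomposition of \<open>y\<close>; by (D2), in the form of \<open>decomps_split_at\<close>, this gives the same multiset.
\<close>

lemma decomps_Suc_Suc_head:
  "decomps dec (Suc (Suc n)) a =
   (\<Sum>(x, y)\<in>#dec a. image_mset ((#) x) (decomps dec (Suc n) y))"
proof (induction n)
  case 0
  show ?case
    by (simp add: split_at_def case_prod_unfold)
next
  case (Suc n)
  have split_tail: "split_at dec 1 (x # ys) = image_mset ((#) x) (split_at dec 0 ys)" for x ys
    by (simp add: split_at_def multiset.map_comp o_def case_prod_unfold)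
  have "decomps dec (Suc (Suc (Suc n))) a =
      (\<Sum>xs\<in>#decomps dec (Suc (Suc n)) a. split_at dec 1 xs)"
    by (rule decomps_split_at) simp
  also have "\<dots> = (\<Sum>(x, y)\<in>#dec a. \<Sum>ys\<in>#decomps dec (Suc n) y. split_at dec 1 (x # ys))"
    by (simp only: Suc.IH sum_mset_image_sum_mset case_prod_unfold) (simp add: multiset.map_comp o_def)
  finally show ?case
    by (simp add: image_mset_sum_mset split_tail del: One_nat_def)
qed

text \<open>
  In this direction splitting the head is what is needed, since the head of \<open>xs @ [y]\<close> is that of \<open>xs\<close>
  as soon as \<open>xs\<close> is nonempty.
\<close>

lemma decomps_Suc_Suc_last:
  "decomps dec (Suc (Suc n)) a =
   (\<Sum>(x, y)\<in>#dec a. image_mset (\<lambda>xs. xs @ [y]) (decomps dec (Suc n) x))"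
proof (induction n)
  case 0
  show ?case
    by (simp add: split_at_def case_prod_unfold)
next
  case (Suc n)
  have split: "split_at dec 0 (xs @ [y]) = image_mset (\<lambda>xs. xs @ [y]) (split_at dec 0 xs)"
    if "xs \<in># decomps dec (Suc n) x" for xs x y
    using length_decomps[OF that]
    by (cases xs) (simp_all add: split_at_def multiset.map_comp o_def case_prod_unfold)
  have "decomps dec (Suc (Suc (Suc n))) a =
      (\<Sum>xs\<in>#decomps dec (Suc (Suc n)) a. split_at dec 0 xs)"
    by simp
  also have "\<dots> = (\<Sum>(x, y)\<in>#dec a. \<Sum>xs\<in>#decomps dec (Suc n) x. split_at dec 0 (xs @ [y]))"
    by (simp only: Suc.IH sum_mset_image_sum_mset case_prod_unfold) (simp add: multiset.map_comp o_def)
  also have "\<dots> = (\<Sum>(x, y)\<in>#dec a. \<Sum>xs\<in>#decomps dec (Suc n) x.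
      image_mset (\<lambda>xs. xs @ [y]) (split_at dec 0 xs))"
    by (intro arg_cong[where f = sum_mset] image_mset_cong)
      (auto simp del: decomps.simps(3) intro!: arg_cong[where f = sum_mset] image_mset_cong split)
  finally show ?case
    by (simp add: image_mset_sum_mset)
qed

abbreviation mult (infixl "\<odot>" 70) where "mult \<equiv> comp_mult compos"

text \<open>The map \<open>J = id - e\<close> on basis elements.\<close>

definition nonvoid_basis :: "'c \<Rightarrow> 'c \<Rightarrow>\<^sub>0 'k::field" where
  "nonvoid_basis a = (if a = void then 0 else basis a)"

text \<open>
  The convolution power \<open>J\<^sup>\<star>\<^sup>n\<close> on basis elements, as is shown by the two recursions
  \<open>nonvoid_power_Suc_left\<close> and \<open>nonvoid_power_Suc_right\<close>. The case \<open>n = 0\<close> has to be given separately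
  because \<open>decomps dec 0 a\<close> is empty, also for \<open>a = void\<close>. Summing over all decompositions, with \<open>J\<close>
  killing those that have a component \<open>void\<close>, keeps the recursions free of side conditions.
\<close>

definition nonvoid_power :: "nat \<Rightarrow> 'c \<Rightarrow> 'c \<Rightarrow>\<^sub>0 'k::field" where
  "nonvoid_power n a =
     (if n = 0 then scal (void_counit void (basis a)) (basis void)
      else \<Sum>xs\<in>#decomps dec n a. foldr (\<odot>) (map nonvoid_basis xs) (basis void))"

lemma nonvoid_power_0: "nonvoid_power 0 a = (if a = void then basis void else 0)"
  by (simp add: nonvoid_power_def void_counit_basis)

lemma nonvoid_power_1: "nonvoid_power (Suc 0) a = nonvoid_basis a"
  by (simp add: nonvoid_power_def comp_mult_void_right)

lemma foldr_comp_mult_snoc: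
  "foldr (\<odot>) (us @ [u]) (basis void) = foldr (\<odot>) us (basis void) \<odot> u"
  by (induction us) (simp_all add: comp_mult_assoc comp_mult_void_left comp_mult_void_right)

lemma nonvoid_power_Suc_left:
  "nonvoid_power (Suc n) a =
   (\<Sum>(x, y)\<in>#dec a. nonvoid_basis x \<odot> (nonvoid_power n y :: 'c \<Rightarrow>\<^sub>0 'k::field))"
proof (cases n)
  case 0
  have "(\<lambda>(x, y). nonvoid_basis x \<odot> (nonvoid_power 0 y :: 'c \<Rightarrow>\<^sub>0 'k)) =
      (\<lambda>(x, y). if y = void then nonvoid_basis x else 0)"
    by (auto simp: nonvoid_power_0 comp_mult_void_right)
  then show ?thesis
    by (simp add: 0 nonvoid_power_1 sum_dec_right_void)
next
  case (Suc m)
  then show ?thesis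
    by (simp del: decomps.simps(3) add: nonvoid_power_def decomps_Suc_Suc_head
        sum_mset_image_sum_mset case_prod_unfold multiset.map_comp o_def comp_mult_sum_mset)
qed

lemma nonvoid_power_Suc_right:
  "nonvoid_power (Suc n) a =
   (\<Sum>(x, y)\<in>#dec a. (nonvoid_power n x :: 'c \<Rightarrow>\<^sub>0 'k::field) \<odot> nonvoid_basis y)"
proof (cases n)
  case 0
  have "(\<lambda>(x, y). (nonvoid_power 0 x :: 'c \<Rightarrow>\<^sub>0 'k) \<odot> nonvoid_basis y) =
      (\<lambda>(x, y). if x = void then nonvoid_basis y else 0)"
    by (auto simp: nonvoid_power_0 comp_mult_void_left)
  then show ?thesis
    by (simp add: 0 nonvoid_power_1 sum_dec_left_void)
next
  case (Suc m)
  then show ?thesis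
    by (simp del: decomps.simps(3) foldr_append add: nonvoid_power_def decomps_Suc_Suc_last
        sum_mset_image_sum_mset case_prod_unfold multiset.map_comp o_def comp_mult_sum_mset
        foldr_comp_mult_snoc)
qed

text \<open>\<open>id \<star> J\<^sup>\<star>\<^sup>n = (e + J) \<star> J\<^sup>\<star>\<^sup>n = J\<^sup>\<star>\<^sup>n + J\<^sup>\<star>\<^sup>n\<^sup>+\<^sup>1\<close>\<close>

lemma sum_dec_basis_mult_power:
  "(\<Sum>(x, y)\<in>#dec a. basis x \<odot> nonvoid_power n y) =
   nonvoid_power n a + (nonvoid_power (Suc n) a :: 'c \<Rightarrow>\<^sub>0 'k::field)"
proof -
  have "(\<Sum>(x, y)\<in>#dec a. basis x \<odot> (nonvoid_power n y :: 'c \<Rightarrow>\<^sub>0 'k)) =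
      (\<Sum>(x, y)\<in>#dec a. (if x = void then nonvoid_power n y else 0) +
         nonvoid_basis x \<odot> nonvoid_power n y)"
    by (intro arg_cong[where f = sum_mset] image_mset_cong)
      (auto simp: nonvoid_basis_def comp_mult_void_left)
  then show ?thesis
    by (simp add: nonvoid_power_Suc_left sum_dec_left_void[unfolded case_prod_unfold]
        case_prod_unfold sum_mset.distrib)
qed

text \<open>\<open>J\<^sup>\<star>\<^sup>n \<star> id = J\<^sup>\<star>\<^sup>n \<star> (e + J) = J\<^sup>\<star>\<^sup>n + J\<^sup>\<star>\<^sup>n\<^sup>+\<^sup>1\<close>\<close>

lemma sum_dec_power_mult_basis:
  "(\<Sum>(x, y)\<in>#dec a. nonvoid_power n x \<odot> basis y) =
   nonvoid_power n a + (nonvoid_power (Suc n) a :: 'c \<Rightarrow>\<^sub>0 'k::field)"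
proof -
  have "(\<Sum>(x, y)\<in>#dec a. (nonvoid_power n x :: 'c \<Rightarrow>\<^sub>0 'k) \<odot> basis y) =
      (\<Sum>(x, y)\<in>#dec a. (if y = void then nonvoid_power n x else 0) +
         nonvoid_power n x \<odot> nonvoid_basis y)"
    by (intro arg_cong[where f = sum_mset] image_mset_cong)
      (auto simp: nonvoid_basis_def comp_mult_void_right)
  then show ?thesis
    by (simp add: nonvoid_power_Suc_right sum_dec_right_void[unfolded case_prod_unfold]
        case_prod_unfold sum_mset.distrib)
qed

lemma foldr_nonvoid_basis:
  "foldr (\<odot>) (map nonvoid_basis xs) u =
   (if void \<in> set xs then 0 else foldr (\<odot>) (map basis xs) u)"
  by (induction xs) (simp_all add: nonvoid_basis_def)

lemma nonvoid_power_eq_sum_nonvoid_decomps: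
  "n > 0 \<Longrightarrow> nonvoid_power n a =
     (\<Sum>xs\<in>#nonvoid_decomps dec void n a. foldr (\<odot>) (map basis xs) (basis void))"
proof -
  have "(\<Sum>xs\<in>#A. foldr (\<odot>) (map nonvoid_basis xs) (basis void)) =
      (\<Sum>xs\<in>#{#xs \<in># A. void \<notin> set xs#}. foldr (\<odot>) (map basis xs) (basis void))" for A
    by (induction A) (simp_all add: foldr_nonvoid_basis)
  then show "n > 0 \<Longrightarrow> ?thesis"
    by (simp add: nonvoid_power_def nonvoid_decomps_def)
qed

lemma nonvoid_power_void: "n > 0 \<Longrightarrow> nonvoid_power n void = 0"
  by (cases n) (simp_all add: nonvoid_power_Suc_left D3_void nonvoid_basis_def)

text \<open>
  The antipode is the geometric series. The zeroth term \<open>e\<close> accounts for \<open>S void = void\<close>, which is why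
  \<open>N\<close> has to be positive; for other basis elements it vanishes. Any sufficiently large \<open>N\<close> is allowed,
  so that finitely many basis elements can share the same one.
\<close>

lemma antipode_basis:
  assumes N: "\<forall>n\<ge>N. nonvoid_decomps dec void n a = {#}" and "N > 0"
  shows "antipode compos dec void (basis a) =
    (\<Sum>n<N. scal ((-1) ^ n) (nonvoid_power n a :: 'c \<Rightarrow>\<^sub>0 'k::field))"
proof (cases "a = void")
  case True
  have "(\<Sum>n<N. scal ((-1) ^ n) (nonvoid_power n void :: 'c \<Rightarrow>\<^sub>0 'k)) =
      (\<Sum>n\<in>{0}. scal ((-1) ^ n) (nonvoid_power n void))"
    using \<open>N > 0\<close> by (intro sum.mono_neutral_right) (auto simp: nonvoid_power_void)
  then show ?thesis
    using True by (simp add: antipode_def lin_ext_basis nonvoid_power_0)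
next
  case False
  let ?I = "{n. nonvoid_decomps dec void n a \<noteq> {#}}"
  have I: "?I \<subseteq> {..<N}" "0 \<notin> ?I"
    using N by (auto simp: nonvoid_decomps_def not_less[symmetric])
  have "(\<Sum>n<N. scal ((-1) ^ n) (nonvoid_power n a :: 'c \<Rightarrow>\<^sub>0 'k)) =
      (\<Sum>n\<in>?I. scal ((-1) ^ n) (nonvoid_power n a))"
  proof (rule sum.mono_neutral_right)
    show "\<forall>n\<in>{..<N} - ?I. scal ((-1) ^ n) (nonvoid_power n a :: 'c \<Rightarrow>\<^sub>0 'k) = 0"
    proof
      fix n assume "n \<in> {..<N} - ?I"
      then show "scal ((-1) ^ n) (nonvoid_power n a :: 'c \<Rightarrow>\<^sub>0 'k) = 0"
        using False
        by (cases "n = 0") (auto simp: nonvoid_power_0 nonvoid_power_eq_sum_nonvoid_decomps)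
    qed
  qed (use I in auto)
  also have "\<dots> = (\<Sum>n\<in>?I. \<Sum>xs\<in>#nonvoid_decomps dec void n a.
      scal ((-1) ^ n) (foldr (\<odot>) (map basis xs) (basis void)))"
  proof (rule sum.cong[OF refl])
    fix n assume "n \<in> ?I"
    then have "n > 0"
      using I(2) by (cases n) auto
    then show "scal ((-1) ^ n) (nonvoid_power n a :: 'c \<Rightarrow>\<^sub>0 'k) =
        (\<Sum>xs\<in>#nonvoid_decomps dec void n a.
          scal ((-1) ^ n) (foldr (\<odot>) (map basis xs) (basis void)))"
      by (simp add: nonvoid_power_eq_sum_nonvoid_decomps scal_sum_mset)
  qed
  finally show ?thesis
    using False by (simp add: antipode_def lin_ext_basis)
qed

lemma alternating_telescope:
  "(\<Sum>n<N. scal ((-1) ^ n) (f n + f (Suc n))) = f 0 - scal ((-1) ^ N) (f N)"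
  by (induction N) (simp_all add: scal.scale_right_distrib)

lemma mult_tensor_map_basis:
  "mul_map (\<odot>) (tensor_map f g (dec_comult dec (basis a :: 'c \<Rightarrow>\<^sub>0 'k::field))) =
   (\<Sum>(x, y)\<in>#dec a. f (basis x) \<odot> g (basis y))"
proof -
  have "mul_map (\<odot>) (\<Sum>p\<in>#A. u p) = (\<Sum>p\<in>#A. mul_map (\<odot>) (u p))"
    for A and u :: "'c \<times> 'c \<Rightarrow> ('c \<times> 'c) \<Rightarrow>\<^sub>0 'k"
    by (simp add: mul_map_def lin_ext_sum_mset)
  then show ?thesis
    by (simp add: dec_comult_basis tensor_map_def lin_ext_mset_vector case_prod_unfold
        mul_map_comp_mult_tensor)
qed

text \<open>The inverse property \<open>id \<star> S = e = S \<star> id\<close> on basis elements, by telescoping.\<close>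

lemma antipode_convolution:
  fixes a :: 'c
  assumes nilpotent: "\<And>a. \<exists>N. \<forall>n\<ge>N. nonvoid_decomps dec void n a = {#}"
  defines "S \<equiv> antipode compos dec void :: ('c \<Rightarrow>\<^sub>0 'k::field) \<Rightarrow> _"
  shows "(\<Sum>(x, y)\<in>#dec a. basis x \<odot> S (basis y)) = nonvoid_power 0 a"
    and "(\<Sum>(x, y)\<in>#dec a. S (basis x) \<odot> basis y) = nonvoid_power 0 a"
proof -
  obtain M where M: "\<And>b n. n \<ge> M b \<Longrightarrow> nonvoid_decomps dec void n b = {#}"
    using nilpotent by metis
  \<comment> \<open>one truncation bound for \<open>a\<close> and all components of its decompositions, so that sums can be swapped\<close>
  define B where "B = insert a (fst ` set_mset (dec a) \<union> snd ` set_mset (dec a))"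
  define N where "N = Suc (\<Sum>b\<in>B. M b)"
  then have "N > 0"
    by simp
  have "M b \<le> N" if "b \<in> B" for b
    using that member_le_sum[of b B M] by (simp add: N_def B_def)
  then have N: "\<forall>n\<ge>N. nonvoid_decomps dec void n b = {#}" if "b \<in> B" for b
    using that M order_trans by blast
  have S: "S (basis b) = (\<Sum>n<N. scal ((-1) ^ n) (nonvoid_power n b))" if "b \<in> B" for b
    unfolding S_def using N[OF that] \<open>N > 0\<close> by (rule antipode_basis)
  have dec_B: "x \<in> B" "y \<in> B" if "(x, y) \<in># dec a" for x y
    using that by (force simp: B_def)+
  have swap: "(\<Sum>p\<in>#A. \<Sum>n<N. f p n) = (\<Sum>n<N. \<Sum>p\<in>#A. f p n)"
    for A :: "('c \<times> 'c) multiset" and f :: "_ \<Rightarrow> _ \<Rightarrow> 'c \<Rightarrow>\<^sub>0 'k"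
    by (induction A) (simp_all add: sum.distrib)
  have "nonvoid_power N a = (0 :: 'c \<Rightarrow>\<^sub>0 'k)"
    using N[of a] \<open>N > 0\<close> by (simp add: nonvoid_power_eq_sum_nonvoid_decomps B_def)
  then have series: "(\<Sum>n<N. scal ((-1) ^ n) (nonvoid_power n a + nonvoid_power (Suc n) a)) =
      (nonvoid_power 0 a :: 'c \<Rightarrow>\<^sub>0 'k)"
    by (simp add: alternating_telescope[of "\<lambda>n. nonvoid_power n a"])
  have "(\<Sum>(x, y)\<in>#dec a. basis x \<odot> S (basis y)) =
      (\<Sum>p\<in>#dec a. \<Sum>n<N. scal ((-1) ^ n) (basis (fst p) \<odot> nonvoid_power n (snd p)))"
    by (intro arg_cong[where f = sum_mset] image_mset_cong)
      (auto simp: S dec_B comp_mult_sum)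
  also have "\<dots> = nonvoid_power 0 a"
    unfolding swap series[symmetric]
    by (simp add: sum_dec_basis_mult_power[unfolded case_prod_unfold] flip: scal_sum_mset)
  finally show "(\<Sum>(x, y)\<in>#dec a. basis x \<odot> S (basis y)) = nonvoid_power 0 a" .
  have "(\<Sum>(x, y)\<in>#dec a. S (basis x) \<odot> basis y) =
      (\<Sum>p\<in>#dec a. \<Sum>n<N. scal ((-1) ^ n) (nonvoid_power n (fst p) \<odot> basis (snd p)))"
    by (intro arg_cong[where f = sum_mset] image_mset_cong)
      (auto simp: S dec_B comp_mult_sum)
  also have "\<dots> = nonvoid_power 0 a"
    unfolding swap series[symmetric]
    by (simp add: sum_dec_power_mult_basis[unfolded case_prod_unfold] flip: scal_sum_mset)
  finally show "(\<Sum>(x, y)\<in>#dec a. S (basis x) \<odot> basis y) = nonvoid_power 0 a" .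
qed

theorem hopf_algebra_comp_dec:
  assumes nilpotent: "\<And>a. \<exists>N. \<forall>n\<ge>N. nonvoid_decomps dec void n a = {#}"
  shows "hopf_algebra (comp_mult compos) (basis void :: 'c \<Rightarrow>\<^sub>0 'k::field) (dec_comult dec)
    (void_counit void) (antipode compos dec void)"
proof (intro hopf_algebra.intro hopf_algebra_axioms.intro bialgebra_comp_dec)
  show "linear_map (antipode compos dec void :: ('c \<Rightarrow>\<^sub>0 'k) \<Rightarrow> _)"
    unfolding antipode_def by (rule linear_lin_ext)
  fix x :: "'c \<Rightarrow>\<^sub>0 'k"
  show "mul_map (\<odot>) (tensor_map id (antipode compos dec void) (dec_comult dec x)) =
      scal (void_counit void x) (basis void)"
  proof (induction x rule: basis_induct)
    case (basis a)
    show ?case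
      using antipode_convolution(1)[OF nilpotent, of a]
      by (simp add: mult_tensor_map_basis nonvoid_power_def)
  qed (simp_all add: mul_map_def tensor_map_def void_counit_eq_lookup lookup_add lookup_scal
      scal.scale_left_distrib)
  show "mul_map (\<odot>) (tensor_map (antipode compos dec void) id (dec_comult dec x)) =
      scal (void_counit void x) (basis void)"
  proof (induction x rule: basis_induct)
    case (basis a)
    show ?case
      using antipode_convolution(2)[OF nilpotent, of a]
      by (simp add: mult_tensor_map_basis nonvoid_power_def)
  qed (simp_all add: mul_map_def tensor_map_def void_counit_eq_lookup lookup_add lookup_scal
      scal.scale_left_distrib)
qed

end

theorem proposition3:
  fixes compos :: "'c::countable \<Rightarrow> 'c \<Rightarrow> 'c multiset"
    and dec :: "'c \<Rightarrow> ('c \<times> 'c) multiset"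
    and void :: 'c
  assumes "comp_decomp_rules compos dec void"
    and "\<And>a. \<exists>N. \<forall>n\<ge>N. \<not> (\<exists>xs. xs \<in># decomps dec n a \<and> void \<notin> set xs)"
  shows "hopf_algebra
           (comp_mult compos :: ('c \<Rightarrow>\<^sub>0 'k::field) \<Rightarrow> ('c \<Rightarrow>\<^sub>0 'k) \<Rightarrow> ('c \<Rightarrow>\<^sub>0 'k))
           (basis void) (dec_comult dec) (void_counit void) (antipode compos dec void)"
proof (rule comp_decomp_rules.hopf_algebra_comp_dec[OF assms(1)])
  fix a
  show "\<exists>N. \<forall>n\<ge>N. nonvoid_decomps dec void n a = {#}"
    using assms(2)[of a] by (auto simp: nonvoid_decomps_def)
qed

end
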